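(* For each positive integer $m$, let $N_m$ be the cardinality of the minimal square-free left cycle set of multipermutational level $m$. Then $$N_m\leq 2^{m-2}-6\cdot 2^{m-6}+1$$ for every integer $m>5$.
   Context: A left cycle set is a non-empty set $X$ with a binary operation $\cdot$ such that every left multiplication $\sigma_x:X\to X$, $y\mapsto x\cdot y$, is bijective and $(x\cdot y)\cdot(x\cdot z)=(y\cdot x)\cdot(y\cdot z)$ for all $x,y,z\in X$. It is non-degenerate if the squaring map $x\mapsto x\cdot x$ is bijective; by convention, "left cycle set" always means non-degenerate left cycle set. It is square-free if $x\cdot x=x$ for all $x\in X$. The retraction of $X$ is the set $\sigma(X)=\{\sigma_x : x\in X\}\subseteq \mathrm{Sym}(X)$ with the (well-defined) operation $\sigma_x\cdot\sigma_y:=\sigma_{x\cdot y}$; it is again a non-degenerate left cycle set. Put $\sigma^0(X):=X$ and $\sigma^n(X):=\sigma(\sigma^{n-1}(X))$ for $n\geq 1$. $X$ is multipermutational of level $m$ if $m$ is the minimal non-negative integer such that $\sigma^m(X)$ has cardinality one. *)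

theory Defs
  imports Main "HOL-Library.FuncSet"
begin

record 'a magma =
  carrier :: "'a set"
  op :: "'a \<Rightarrow> 'a \<Rightarrow> 'a"

(* Restricting to the carrier makes equality of these functions coincide with equality
   as elements of Sym(X). *)
definition left_mult :: "'a magma \<Rightarrow> 'a \<Rightarrow> ('a \<Rightarrow> 'a)" where
  "left_mult X x = restrict (op X x) (carrier X)"

definition left_cycle_set :: "'a magma \<Rightarrow> bool" where
  "left_cycle_set X \<longleftrightarrow>
     carrier X \<noteq> {} \<and>
     (\<forall>x\<in>carrier X. bij_betw (op X x) (carrier X) (carrier X)) \<and>
     (\<forall>x\<in>carrier X. \<forall>y\<in>carrier X. \<forall>z\<in>carrier X.
        op X (op X x y) (op X x z) = op X (op X y x) (op X y z)) \<and>
     bij_betw (\<lambda>x. op X x x) (carrier X) (carrier X)"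

definition square_free :: "'a magma \<Rightarrow> bool" where
  "square_free X \<longleftrightarrow> (\<forall>x\<in>carrier X. op X x x = x)"

definition preimage_choice :: "'a magma \<Rightarrow> ('a \<Rightarrow> 'a) \<Rightarrow> 'a" where
  "preimage_choice X = inv_into (carrier X) (left_mult X)"

definition retraction :: "'a magma \<Rightarrow> ('a \<Rightarrow> 'a) magma" where
  "retraction X =
     \<lparr> carrier = left_mult X ` carrier X,
       op = (\<lambda>f g. left_mult X (op X (preimage_choice X f) (preimage_choice X g))) \<rparr>"

lemma retraction_op:
  assumes "left_cycle_set X" and x: "x \<in> carrier X" and y: "y \<in> carrier X"
  shows "op (retraction X) (left_mult X x) (left_mult X y) = left_mult X (op X x y)"
proof -
  let ?C = "carrier X"
  let ?s = "left_mult X"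
  have bij: "bij_betw (op X a) ?C ?C" if "a \<in> ?C" for a
    using assms(1) that by (simp add: left_cycle_set_def)
  have cyc: "op X (op X a b) (op X a c) = op X (op X b a) (op X b c)"
    if "a \<in> ?C" "b \<in> ?C" "c \<in> ?C" for a b c
    using assms(1) that by (simp add: left_cycle_set_def)
  define x' where "x' = preimage_choice X (?s x)"
  define y' where "y' = preimage_choice X (?s y)"
  have x': "x' \<in> ?C" "?s x' = ?s x"
    unfolding x'_def preimage_choice_def using x by (auto intro: inv_into_into f_inv_into_f)
  have y': "y' \<in> ?C" "?s y' = ?s y"
    unfolding y'_def preimage_choice_def using y by (auto intro: inv_into_into f_inv_into_f)
  have eqx: "op X x' c = op X x c" if "c \<in> ?C" for c
    using fun_cong[OF x'(2), of c] that by (simp add: left_mult_def)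
  have eqy: "op X y' c = op X y c" if "c \<in> ?C" for c
    using fun_cong[OF y'(2), of c] that by (simp add: left_mult_def)
  have "op X (op X x' y') w = op X (op X x y) w" if w: "w \<in> ?C" for w
  proof -
    obtain z where z: "z \<in> ?C" "w = op X x z"
      using bij[OF x] w by (auto simp: bij_betw_def image_iff)
    have "op X (op X x' y') w = op X (op X x y') (op X x z)"
      using eqx y'(1) z by simp
    also have "\<dots> = op X (op X y' x) (op X y' z)"
      using cyc[OF x y'(1) z(1)] .
    also have "\<dots> = op X (op X y x) (op X y z)"
      using eqy x z by simp
    also have "\<dots> = op X (op X x y) w"
      using cyc[OF x y z(1)] z(2) by simp
    finally show ?thesis .
  qed
  then have "left_mult X (op X x' y') = left_mult X (op X x y)"
    by (auto simp: left_mult_def restrict_def)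
  then show ?thesis
    by (simp add: retraction_def x'_def y'_def)
qed

(* Iterating the retraction would change the type at every step.  The retraction is therefore
   transported back to the type of X along the injection f \<mapsto> preimage_choice X f of
   the set of left multiplications into X; the lemma below states that this is an isomorphic copy. *)
definition retract :: "'a magma \<Rightarrow> 'a magma" where
  "retract X =
     \<lparr> carrier = preimage_choice X ` carrier (retraction X),
       op = (\<lambda>a b. preimage_choice X (op (retraction X) (left_mult X a) (left_mult X b))) \<rparr>"

definition magma_iso :: "('a \<Rightarrow> 'b) \<Rightarrow> 'a magma \<Rightarrow> 'b magma \<Rightarrow> bool" where
  "magma_iso h X Y \<longleftrightarrow>
     bij_betw h (carrier X) (carrier Y) \<and>
     (\<forall>x\<in>carrier X. \<forall>y\<in>carrier X. h (op X x y) = op Y (h x) (h y))"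

lemma retract_iso: "magma_iso (preimage_choice X) (retraction X) (retract X)"
proof -
  have "inj_on (preimage_choice X) (carrier (retraction X))"
    by (simp add: retraction_def preimage_choice_def inj_on_inv_into)
  moreover have "left_mult X (preimage_choice X f) = f" if "f \<in> carrier (retraction X)" for f
    using that by (simp add: retraction_def preimage_choice_def f_inv_into_f)
  ultimately show ?thesis
    by (simp add: magma_iso_def bij_betw_def retract_def)
qed

definition iterated_retract :: "nat \<Rightarrow> 'a magma \<Rightarrow> 'a magma" where
  "iterated_retract n X = (retract ^^ n) X"

definition multiperm_level :: "'a magma \<Rightarrow> nat \<Rightarrow> bool" where
  "multiperm_level X m \<longleftrightarrow>
     card (carrier (iterated_retract m X)) = 1 \<and>
     (\<forall>k<m. card (carrier (iterated_retract k X)) \<noteq> 1)"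

(* Every finite left cycle set is isomorphic to one on a finite set of natural numbers, so
   restricting to the type nat loses nothing.  Finiteness is explicit because card is 0 on infinite sets. *)
definition N :: "nat \<Rightarrow> nat" where
  "N m = (LEAST n. \<exists>X :: nat magma.
            left_cycle_set X \<and> square_free X \<and> multiperm_level X m \<and>
            finite (carrier X) \<and> card (carrier X) = n)"

end

theory Submission
  imports Defs
begin

text \<open>
The bound $10\cdot 2^{i}+1$ at level $6+i$ (the same number as in the theorem, with $i = m - 6$)
is reached by growing a ten-point example of level five.

Two points of \<open>X\<close> have the same image in the \<open>k\<close>-th retraction iff they are related by
\<open>ret_eq X k\<close>, an equivalence defined by recursion on \<open>k\<close> inside \<open>X\<close>. Hence the level is the first
\<open>k\<close> at which this relation is total (\<open>card_iterated_retract\<close>), and no retraction ever has to be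
computed.

Growth comes from gluing two cycle sets side by side, each acting on the other through one fixed
automorphism (\<open>glue\<close>). Suppose \<open>X\<close> has level \<open>k + 1\<close> and its automorphism \<open>f\<close> still moves some
class of \<open>ret_eq X k\<close>. In the \<open>k\<close>-th retraction every point of \<open>X\<close> acts trivially on \<open>X\<close>, while
the points on the other side act by \<open>f\<close>, so the two sides remain distinct one step longer than
\<open>X\<close> itself would last (\<open>not_ret_eq_glue\<close>). This is used twice:

  \<^item> Gluing \<open>X\<close> to a second copy of itself doubles the size and raises the level by one. Exchanging
    the copies is an automorphism that again moves a class at the last nontrivial stage, so the
    step can be repeated (\<open>twistable_double\<close>).
  \<^item> Gluing \<open>X\<close> to a single point raises the level by one at the price of one point, but in
    general no automorphism exchanges \<open>X\<close> with the point, so this is done once, at the end (\<open>multiperm_level_adjoin_point\<close>).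

Starting from ten points at level five, \<open>i\<close> doublings and one extra point give $10\cdot 2^{i}+1$
points at level $6 + i$.
\<close>

section \<open>Multipermutation level via iterated retract equivalences\<close>

definition finite_sf :: "'a magma \<Rightarrow> bool" where
  "finite_sf X \<longleftrightarrow> left_cycle_set X \<and> square_free X \<and> finite (carrier X)"

lemma finite_sf_op_closed:
  "finite_sf X \<Longrightarrow> x \<in> carrier X \<Longrightarrow> y \<in> carrier X \<Longrightarrow> op X x y \<in> carrier X"
  unfolding finite_sf_def left_cycle_set_def bij_betw_def by blast

lemma finite_sf_idem: "finite_sf X \<Longrightarrow> x \<in> carrier X \<Longrightarrow> op X x x = x"
  by (simp add: finite_sf_def square_free_def)

lemma finite_sf_nonempty: "finite_sf X \<Longrightarrow> carrier X \<noteq> {}"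
  by (simp add: finite_sf_def left_cycle_set_def)

lemma finite_sf_surj:
  "finite_sf X \<Longrightarrow> x \<in> carrier X \<Longrightarrow> op X x ` carrier X = carrier X"
  by (simp add: finite_sf_def left_cycle_set_def bij_betw_def)

lemma finite_sf_cycle:
  "finite_sf X \<Longrightarrow> x \<in> carrier X \<Longrightarrow> y \<in> carrier X \<Longrightarrow> z \<in> carrier X \<Longrightarrow>
     op X (op X x y) (op X x z) = op X (op X y x) (op X y z)"
  by (simp add: finite_sf_def left_cycle_set_def)

lemma finite_sfI:
  assumes fin: "finite (carrier X)" and ne: "carrier X \<noteq> {}"
    and idem: "\<And>x. x \<in> carrier X \<Longrightarrow> op X x x = x"
    and surj: "\<And>x. x \<in> carrier X \<Longrightarrow> op X x ` carrier X = carrier X"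
    and cycle: "\<And>x y z. x \<in> carrier X \<Longrightarrow> y \<in> carrier X \<Longrightarrow> z \<in> carrier X \<Longrightarrow>
      op X (op X x y) (op X x z) = op X (op X y x) (op X y z)"
  shows "finite_sf X"
proof -
  have "bij_betw (op X x) (carrier X) (carrier X)" if "x \<in> carrier X" for x
    using surj[OF that] fin by (simp add: bij_betw_def eq_card_imp_inj_on)
  moreover have "bij_betw (\<lambda>x. op X x x) (carrier X) (carrier X)"
    using idem bij_betw_id by (simp add: id_def cong: bij_betw_cong)
  ultimately show ?thesis
    using fin ne idem cycle by (simp add: finite_sf_def left_cycle_set_def square_free_def)
qed

text \<open>This is the kernel of the canonical map from \<open>X\<close> onto its \<open>k\<close>-th retraction. One retraction
identifies points with equal left multiplications; iterating, \<open>x\<close> and \<open>y\<close> are identified one stage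
later when all their products have already been identified.\<close>

fun ret_eq :: "'a magma \<Rightarrow> nat \<Rightarrow> 'a \<Rightarrow> 'a \<Rightarrow> bool" where
  "ret_eq X 0 x y \<longleftrightarrow> x = y"
| "ret_eq X (Suc k) x y \<longleftrightarrow> (\<forall>z\<in>carrier X. ret_eq X k (op X x z) (op X y z))"

lemma ret_eq_refl [simp]: "ret_eq X k x x"
  by (induction k arbitrary: x) auto

lemma ret_eq_sym: "ret_eq X k x y \<Longrightarrow> ret_eq X k y x"
  by (induction k arbitrary: x y) auto

lemma ret_eq_trans: "ret_eq X k x y \<Longrightarrow> ret_eq X k y z \<Longrightarrow> ret_eq X k x z"
proof (induction k arbitrary: x y z)
  case (Suc k)
  then show ?case unfolding ret_eq.simps by blast
qed simp

lemma ret_eq_Suc: "ret_eq X k x y \<Longrightarrow> ret_eq X (Suc k) x y"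
  by (induction k arbitrary: x y) auto

lemma ret_eq_mono: "k \<le> l \<Longrightarrow> ret_eq X k x y \<Longrightarrow> ret_eq X l x y"
  by (induction l rule: dec_induct) (auto intro: ret_eq_Suc simp del: ret_eq.simps)

abbreviation ret_total :: "'a magma \<Rightarrow> nat \<Rightarrow> bool" where
  "ret_total X k \<equiv> \<forall>x\<in>carrier X. \<forall>y\<in>carrier X. ret_eq X k x y"

text \<open>Both the passage to a retraction and the passage to an isomorphic copy are surjective
homomorphisms; treating them together gives each fact about them once.\<close>

definition surj_hom :: "('a \<Rightarrow> 'b) \<Rightarrow> 'a magma \<Rightarrow> 'b magma \<Rightarrow> bool" where
  "surj_hom h X Y \<longleftrightarrow> h ` carrier X = carrier Y \<and>
     (\<forall>x\<in>carrier X. \<forall>y\<in>carrier X. h (op X x y) = op Y (h x) (h y))"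

lemma surj_hom_op:
  "surj_hom h X Y \<Longrightarrow> x \<in> carrier X \<Longrightarrow> y \<in> carrier X \<Longrightarrow> op Y (h x) (h y) = h (op X x y)"
  by (simp add: surj_hom_def)

text \<open>Equations pass to homomorphic images, but bijectivity of left multiplications does not in general:
only surjectivity does. Finiteness closes this gap.\<close>

lemma finite_sf_surj_hom:
  assumes "surj_hom h X Y" and X: "finite_sf X"
  shows "finite_sf Y"
proof -
  have C: "carrier Y = h ` carrier X" using assms by (simp add: surj_hom_def)
  note op = surj_hom_op[OF assms(1)] and cl = finite_sf_op_closed[OF X]
  show ?thesis
  proof (rule finite_sfI)
    show "finite (carrier Y)" "carrier Y \<noteq> {}"
      using X finite_sf_nonempty[OF X] by (auto simp: C finite_sf_def)
    show "op Y x x = x" if "x \<in> carrier Y" for x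
      using that by (auto simp: C op finite_sf_idem[OF X])
    show "op Y x ` carrier Y = carrier Y" if x: "x \<in> carrier Y" for x
    proof -
      obtain a where a: "a \<in> carrier X" "x = h a" using x unfolding C by blast
      have "op Y x ` carrier Y = h ` op X a ` carrier X"
        unfolding C image_image a by (intro image_cong refl) (simp add: op a)
      then show ?thesis by (simp add: finite_sf_surj[OF X a(1)] C)
    qed
    show "op Y (op Y x y) (op Y x z) = op Y (op Y y x) (op Y y z)"
      if xyz: "x \<in> carrier Y" "y \<in> carrier Y" "z \<in> carrier Y" for x y z
    proof -
      obtain a b c where "a \<in> carrier X" "x = h a" "b \<in> carrier X" "y = h b"
        "c \<in> carrier X" "z = h c" using xyz unfolding C by blast
      then show ?thesis using finite_sf_cycle[OF X, of a b c] by (simp add: op cl)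
    qed
  qed
qed

text \<open>For an isomorphism \<open>d = 0\<close>, for the retraction map \<open>d = 1\<close>. The latter says that the equivalences of
the retraction are those of \<open>X\<close> shifted by one stage.\<close>

lemma ret_eq_surj_hom:
  assumes h: "surj_hom h X Y" and X: "finite_sf X"
    and ker: "\<And>x y. x \<in> carrier X \<Longrightarrow> y \<in> carrier X \<Longrightarrow> h x = h y \<longleftrightarrow> ret_eq X d x y"
    and "x \<in> carrier X" "y \<in> carrier X"
  shows "ret_eq Y k (h x) (h y) \<longleftrightarrow> ret_eq X (k + d) x y"
  using assms(4,5)
proof (induction k arbitrary: x y)
  case 0
  then show ?case using ker by simp
next
  case (Suc k)
  have C: "carrier Y = h ` carrier X" using h by (simp add: surj_hom_def)
  show ?case
    using Suc by (simp add: C surj_hom_op[OF h] finite_sf_op_closed[OF X])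
qed

definition ret_rep :: "'a magma \<Rightarrow> 'a \<Rightarrow> 'a" where
  "ret_rep X x = preimage_choice X (left_mult X x)"

lemma surj_hom_retract:
  assumes "left_cycle_set X"
  shows "surj_hom (ret_rep X) X (retract X)"
proof -
  have lm: "left_mult X (ret_rep X x) = left_mult X x" if "x \<in> carrier X" for x
    using that by (simp add: ret_rep_def preimage_choice_def f_inv_into_f)
  show ?thesis
    unfolding surj_hom_def
  proof (intro conjI ballI)
    show "ret_rep X ` carrier X = carrier (retract X)"
      by (simp add: retract_def retraction_def ret_rep_def image_image)
    show "ret_rep X (op X x y) = op (retract X) (ret_rep X x) (ret_rep X y)"
      if "x \<in> carrier X" "y \<in> carrier X" for x y
      using that retraction_op[OF assms that] by (simp add: retract_def lm) (simp add: ret_rep_def)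
  qed
qed

lemma ret_rep_eq_iff:
  assumes "x \<in> carrier X" "y \<in> carrier X"
  shows "ret_rep X x = ret_rep X y \<longleftrightarrow> ret_eq X 1 x y"
proof -
  have "ret_rep X x = ret_rep X y \<longleftrightarrow> left_mult X x = left_mult X y"
    using assms by (auto simp: ret_rep_def preimage_choice_def dest: inv_into_injective)
  also have "\<dots> \<longleftrightarrow> (\<forall>z\<in>carrier X. op X x z = op X y z)"
    by (auto simp: left_mult_def fun_eq_iff restrict_def)
  finally show ?thesis by simp
qed

text \<open>Here the level, defined through iterated retractions, becomes a statement about \<open>ret_eq\<close> in the
original cycle set: the induction peels off the innermost retraction and shifts the stage by one.\<close>

lemma card_iterated_retract:
  assumes "finite_sf X"
  shows "card (carrier (iterated_retract k X)) = 1 \<longleftrightarrow> ret_total X k"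
  using assms
proof (induction k arbitrary: X)
  case 0
  then show ?case
    using finite_sf_nonempty[OF 0] by (auto simp: iterated_retract_def card_1_singleton_iff)
next
  case (Suc k)
  let ?Y = "retract X"
  have h: "surj_hom (ret_rep X) X ?Y"
    using Suc.prems by (simp add: finite_sf_def surj_hom_retract)
  have C: "carrier ?Y = ret_rep X ` carrier X" using h by (simp add: surj_hom_def)
  have "iterated_retract (Suc k) X = iterated_retract k ?Y"
    by (simp add: iterated_retract_def funpow_swap1)
  then have "card (carrier (iterated_retract (Suc k) X)) = 1 \<longleftrightarrow> ret_total ?Y k"
    using Suc.IH[OF finite_sf_surj_hom[OF h Suc.prems]] by simp
  also have "\<dots> \<longleftrightarrow> ret_total X (k + 1)"
    using ret_eq_surj_hom[OF h Suc.prems ret_rep_eq_iff, where k = k]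
    by (simp add: C del: ret_eq.simps)
  finally show ?case by simp
qed

text \<open>Since the equivalences grow with \<open>k\<close>, it is enough to look at one stage to exclude all smaller levels.\<close>

lemma multiperm_level_SucI:
  assumes "finite_sf X" "ret_total X (Suc k)" "\<not> ret_total X k"
  shows "multiperm_level X (Suc k)"
proof -
  have "\<not> ret_total X j" if "j < Suc k" for j
    using assms(3) ret_eq_mono[of j k X] that unfolding less_Suc_eq_le by blast
  then show ?thesis
    using assms(2) unfolding multiperm_level_def card_iterated_retract[OF assms(1)] by blast
qed

section \<open>Gluing two cycle sets along automorphisms\<close>

definition glue :: "'a magma \<Rightarrow> ('a \<Rightarrow> 'a) \<Rightarrow> 'b magma \<Rightarrow> ('b \<Rightarrow> 'b) \<Rightarrow> ('a + 'b) magma" where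
  "glue X f Y g = \<lparr> carrier = carrier X <+> carrier Y,
     op = (\<lambda>u v. case v of
         Inl y \<Rightarrow> Inl (case u of Inl x \<Rightarrow> op X x y | Inr _ \<Rightarrow> f y)
       | Inr y \<Rightarrow> Inr (case u of Inl _ \<Rightarrow> g y | Inr x \<Rightarrow> op Y x y)) \<rparr>"

lemma glue_simps [simp]:
  "carrier (glue X f Y g) = carrier X <+> carrier Y"
  "op (glue X f Y g) (Inl x) (Inl x') = Inl (op X x x')"
  "op (glue X f Y g) (Inr y) (Inl x) = Inl (f x)"
  "op (glue X f Y g) (Inl x) (Inr y) = Inr (g y)"
  "op (glue X f Y g) (Inr y) (Inr y') = Inr (op Y y y')"
  by (simp_all add: glue_def)

text \<open>In the cycle identity, two factors from the same side act on the other side by the same automorphism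
in either order; two factors from different sides reduce the identity to the homomorphism property
of \<open>f\<close> or \<open>g\<close>.\<close>

lemma finite_sf_glue:
  assumes X: "finite_sf X" and Y: "finite_sf Y"
    and f: "magma_iso f X X" and g: "magma_iso g Y Y"
  shows "finite_sf (glue X f Y g)"
proof (rule finite_sfI)
  let ?G = "glue X f Y g"
  have fC: "f ` carrier X = carrier X" and gC: "g ` carrier Y = carrier Y"
    using f g by (simp_all add: magma_iso_def bij_betw_def)
  have fg: "\<And>x x'. x \<in> carrier X \<Longrightarrow> x' \<in> carrier X \<Longrightarrow> f (op X x x') = op X (f x) (f x')"
    "\<And>y y'. y \<in> carrier Y \<Longrightarrow> y' \<in> carrier Y \<Longrightarrow> g (op Y y y') = op Y (g y) (g y')"
    using f g by (simp_all add: magma_iso_def)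
  show "finite (carrier ?G)" "carrier ?G \<noteq> {}"
    using X Y finite_sf_nonempty[OF X] by (auto simp: finite_sf_def)
  show "op ?G u u = u" if "u \<in> carrier ?G" for u
    using that by (auto simp: finite_sf_idem[OF X] finite_sf_idem[OF Y])
  show "op ?G u ` carrier ?G = carrier ?G" if "u \<in> carrier ?G" for u
  proof (cases u)
    case (Inl x)
    then have "op ?G u ` carrier ?G = op X x ` carrier X <+> g ` carrier Y"
      by (simp add: Plus_def image_Un image_image)
    moreover have "x \<in> carrier X" using that Inl by auto
    ultimately show ?thesis by (simp add: finite_sf_surj[OF X] gC)
  next
    case (Inr y)
    then have "op ?G u ` carrier ?G = f ` carrier X <+> op Y y ` carrier Y"
      by (simp add: Plus_def image_Un image_image)
    moreover have "y \<in> carrier Y" using that Inr by auto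
    ultimately show ?thesis by (simp add: finite_sf_surj[OF Y] fC)
  qed
  show "op ?G (op ?G u v) (op ?G u w) = op ?G (op ?G v u) (op ?G v w)"
    if "u \<in> carrier ?G" "v \<in> carrier ?G" "w \<in> carrier ?G" for u v w
    using that by (cases u; cases v; cases w)
      (auto simp: fg finite_sf_cycle[OF X] finite_sf_cycle[OF Y])
qed

text \<open>Two points on the same side act identically on the other side, so gluing neither separates nor
merges points within a side.\<close>

lemma ret_eq_glue_Inl:
  assumes "finite_sf X" "x \<in> carrier X" "x' \<in> carrier X"
  shows "ret_eq (glue X f Y g) k (Inl x) (Inl x') \<longleftrightarrow> ret_eq X k x x'"
  using assms(2,3)
proof (induction k arbitrary: x x')
  case (Suc k)
  then show ?case by (simp add: Plus_def ball_Un finite_sf_op_closed[OF assms(1)])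
qed simp

lemma ret_eq_glue_Inr:
  assumes "finite_sf Y" "y \<in> carrier Y" "y' \<in> carrier Y"
  shows "ret_eq (glue X f Y g) k (Inr y) (Inr y') \<longleftrightarrow> ret_eq Y k y y'"
  using assms(2,3)
proof (induction k arbitrary: y y')
  case (Suc k)
  then show ?case by (simp add: Plus_def ball_Un finite_sf_op_closed[OF assms(1)])
qed simp

text \<open>Products with a common right factor lie on the side of that factor, where everything is identified
at stage \<open>k\<close>; hence one more stage identifies the two sides.\<close>

lemma ret_total_glue:
  assumes X: "finite_sf X" and Y: "finite_sf Y"
    and f: "magma_iso f X X" and g: "magma_iso g Y Y"
    and "ret_total X k" "ret_total Y k"
  shows "ret_total (glue X f Y g) (Suc k)"
proof (intro ballI)
  let ?G = "glue X f Y g"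
  note cl = finite_sf_op_closed[OF finite_sf_glue[OF X Y f g]]
  fix u v assume uv: "u \<in> carrier ?G" "v \<in> carrier ?G"
  have "ret_eq ?G k (op ?G u w) (op ?G v w)" if w: "w \<in> carrier ?G" for w
  proof (cases w)
    case (Inl x)
    then obtain a b where "op ?G u w = Inl a" "op ?G v w = Inl b"
      by (metis glue_simps(2,3) sum.exhaust)
    moreover from this have "a \<in> carrier X" "b \<in> carrier X"
      using cl[OF uv(1) w] cl[OF uv(2) w] by auto
    ultimately show ?thesis using assms(5) ret_eq_glue_Inl[OF X] by metis
  next
    case (Inr y)
    then obtain a b where "op ?G u w = Inr a" "op ?G v w = Inr b"
      by (metis glue_simps(4,5) sum.exhaust)
    moreover from this have "a \<in> carrier Y" "b \<in> carrier Y"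
      using cl[OF uv(1) w] cl[OF uv(2) w] by auto
    ultimately show ?thesis using assms(6) ret_eq_glue_Inr[OF Y] by metis
  qed
  then show "ret_eq ?G (Suc k) u v" by simp
qed

text \<open>The hypothesis carried through the construction. The moved class shows that stage \<open>k\<close> is not yet
trivial, so that \<open>X\<close> has level exactly \<open>k + 1\<close>.\<close>

definition twistable :: "'a magma \<Rightarrow> ('a \<Rightarrow> 'a) \<Rightarrow> nat \<Rightarrow> bool" where
  "twistable X f k \<longleftrightarrow> finite_sf X \<and> magma_iso f X X \<and> ret_total X (Suc k) \<and>
     (\<exists>x\<in>carrier X. \<not> ret_eq X k x (f x))"

text \<open>Take \<open>z\<close> whose class at stage \<open>k\<close> is moved by \<open>f\<close>. If points \<open>x\<close> and \<open>y\<close> of different sides were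
identified at stage \<open>k + 1\<close>, then \<open>x \<cdot> z\<close> and \<open>f z\<close> would be identified at stage \<open>k\<close>. But all left
multiplications of \<open>X\<close> agree at that stage, and \<open>z \<cdot> z = z\<close>, so \<open>x \<cdot> z\<close> is identified with \<open>z\<close>.\<close>

lemma not_ret_eq_glue:
  assumes "twistable X f k" "x \<in> carrier X"
  shows "\<not> ret_eq (glue X f Y g) (Suc k) (Inl x) (Inr y)"
proof
  have X: "finite_sf X" and f: "magma_iso f X X" and tot: "ret_total X (Suc k)"
    using assms by (auto simp: twistable_def)
  obtain z where z: "z \<in> carrier X" "\<not> ret_eq X k z (f z)"
    using assms by (auto simp: twistable_def)
  have fz: "f z \<in> carrier X" using f z by (auto simp: magma_iso_def bij_betw_def)
  assume "ret_eq (glue X f Y g) (Suc k) (Inl x) (Inr y)"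
  then have "ret_eq (glue X f Y g) k (Inl (op X x z)) (Inl (f z))"
    using z by (auto dest!: bspec[where x = "Inl z"])
  then have "ret_eq X k (op X x z) (f z)"
    by (simp only: ret_eq_glue_Inl[OF X finite_sf_op_closed[OF X assms(2) z(1)] fz])
  moreover have "ret_eq X k (op X z z) (op X x z)"
    using tot z assms(2) by simp
  then have "ret_eq X k z (op X x z)" using finite_sf_idem[OF X z(1)] by simp
  ultimately show False using ret_eq_trans[of X k z "op X x z" "f z"] z(2) by simp
qed

text \<open>The class moved by the exchange of the two copies is an entire copy, as the copies are still distinct
at stage \<open>k + 1\<close>.\<close>

lemma twistable_double:
  assumes T: "twistable X f k"
  shows "twistable (glue X f X f) (\<lambda>u. case u of Inl x \<Rightarrow> Inr x | Inr x \<Rightarrow> Inl x) (Suc k)"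
    (is "twistable ?G ?s _")
proof -
  have X: "finite_sf X" and f: "magma_iso f X X" and tot: "ret_total X (Suc k)"
    using T by (auto simp: twistable_def)
  have "?s ` carrier ?G = carrier ?G"
    by (force simp: Plus_def image_iff)
  moreover have "inj_on ?s (carrier ?G)"
    by (auto simp: inj_on_def)
  ultimately have "magma_iso ?s ?G ?G"
    by (auto simp: magma_iso_def bij_betw_def)
  moreover obtain x where "x \<in> carrier X" using finite_sf_nonempty[OF X] by blast
  then have "\<exists>u\<in>carrier ?G. \<not> ret_eq ?G (Suc k) u (?s u)"
    using not_ret_eq_glue[OF T] by (intro bexI[of _ "Inl x"]) auto
  ultimately show ?thesis
    unfolding twistable_def
    using finite_sf_glue[OF X X f f] ret_total_glue[OF X X f f tot tot] by blast
qed

lemma finite_sf_point: "finite_sf \<lparr>carrier = {p}, op = \<lambda>_ y. y\<rparr>"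
  by (rule finite_sfI) auto

lemma multiperm_level_adjoin_point:
  fixes p :: 'b
  assumes T: "twistable X f k"
  defines "P \<equiv> \<lparr>carrier = {p}, op = \<lambda>_ y. y\<rparr>"
  shows "finite_sf (glue X f P id)" "multiperm_level (glue X f P id) (Suc (Suc k))"
proof -
  have X: "finite_sf X" and f: "magma_iso f X X" and tot: "ret_total X (Suc k)"
    using T by (auto simp: twistable_def)
  have P: "finite_sf P" "magma_iso id P P" "ret_total P (Suc k)"
    by (simp_all add: P_def finite_sf_point magma_iso_def)
  show G: "finite_sf (glue X f P id)" using finite_sf_glue[OF X P(1) f P(2)] .
  obtain x where x: "x \<in> carrier X" using finite_sf_nonempty[OF X] by blast
  have "Inl x \<in> carrier (glue X f P id)" "Inr p \<in> carrier (glue X f P id)"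
    using x by (simp_all add: P_def InlI InrI)
  then have "\<not> ret_total (glue X f P id) (Suc k)"
    using not_ret_eq_glue[OF T x] by (metis (no_types))
  then show "multiperm_level (glue X f P id) (Suc (Suc k))"
    by (rule multiperm_level_SucI[OF G ret_total_glue[OF X P(1) f P(2) tot P(3)]])
qed

section \<open>Transport to the natural numbers\<close>

text \<open>Gluing changes the carrier type, so an iteration has to return to a fixed type after every step; the
natural numbers are also the type over which the minimal cardinality is taken.\<close>

definition image_magma :: "('a \<Rightarrow> 'b) \<Rightarrow> 'a magma \<Rightarrow> 'b magma" where
  "image_magma h X = \<lparr> carrier = h ` carrier X,
     op = (\<lambda>a b. h (op X (inv_into (carrier X) h a) (inv_into (carrier X) h b))) \<rparr>"

lemma surj_hom_image_magma:
  "inj_on h (carrier X) \<Longrightarrow> surj_hom h X (image_magma h X)"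
  by (simp add: surj_hom_def image_magma_def)

lemma ret_eq_image_magma:
  assumes "finite_sf X" "inj_on h (carrier X)" "x \<in> carrier X" "y \<in> carrier X"
  shows "ret_eq (image_magma h X) k (h x) (h y) \<longleftrightarrow> ret_eq X k x y"
  using ret_eq_surj_hom[OF surj_hom_image_magma[OF assms(2)] assms(1), of 0] assms
  by (simp add: inj_on_eq_iff)

lemma finite_nat_injection:
  assumes "finite A"
  obtains h :: "'a \<Rightarrow> nat" where "inj_on h A"
  using finite_imp_inj_to_nat_seg[OF assms] by blast

lemma nat_copy_twistable:
  assumes "twistable X f k"
  obtains Y :: "nat magma" and g where "twistable Y g k" "card (carrier Y) = card (carrier X)"
proof -
  have X: "finite_sf X" and f: "magma_iso f X X" and tot: "ret_total X (Suc k)"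
    using assms by (auto simp: twistable_def)
  obtain h :: "'a \<Rightarrow> nat" where h: "inj_on h (carrier X)"
    using X finite_nat_injection unfolding finite_sf_def by blast
  let ?Y = "image_magma h X" and ?g = "\<lambda>a. h (f (inv_into (carrier X) h a))"
  have C: "carrier ?Y = h ` carrier X" by (simp add: image_magma_def)
  note hom = surj_hom_image_magma[OF h] and eq = ret_eq_image_magma[OF X h]
  have fC: "f ` carrier X = carrier X" and finj: "inj_on f (carrier X)"
    and fop: "\<And>x y. x \<in> carrier X \<Longrightarrow> y \<in> carrier X \<Longrightarrow> f (op X x y) = op X (f x) (f y)"
    using f by (simp_all add: magma_iso_def bij_betw_def)
  have fcl: "\<And>x. x \<in> carrier X \<Longrightarrow> f x \<in> carrier X" using fC by blast
  have g: "?g (h x) = h (f x)" if "x \<in> carrier X" for x using that h by simp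
  have "magma_iso ?g ?Y ?Y"
    unfolding magma_iso_def
  proof (intro conjI ballI bij_betw_imageI)
    show "?g ` carrier ?Y = carrier ?Y"
      unfolding C image_image using fC g by (metis (no_types, lifting) image_cong image_image)
    show "inj_on ?g (carrier ?Y)"
      using h finj fcl by (auto simp: C inj_on_eq_iff intro!: inj_onI)
    show "?g (op ?Y a b) = op ?Y (?g a) (?g b)" if "a \<in> carrier ?Y" "b \<in> carrier ?Y" for a b
      using that
      by (auto simp: C surj_hom_op[OF hom] g fop fcl finite_sf_op_closed[OF X] simp del: inv_into_f_f)
  qed
  moreover obtain x where "x \<in> carrier X" "\<not> ret_eq X k x (f x)"
    using assms by (auto simp: twistable_def)
  then have "\<exists>a\<in>carrier ?Y. \<not> ret_eq ?Y k a (?g a)"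
    using eq fcl g unfolding C by (metis imageI)
  moreover have "ret_total ?Y (Suc k)"
    using tot eq unfolding C by blast
  ultimately have "twistable ?Y ?g k"
    using finite_sf_surj_hom[OF hom X] by (simp add: twistable_def del: ret_eq.simps)
  then show thesis using that card_image[OF h] C by metis
qed

lemma N_le:
  fixes X :: "'a magma"
  assumes X: "finite_sf X" and lev: "multiperm_level X m"
  shows "N m \<le> card (carrier X)"
proof -
  obtain h :: "'a \<Rightarrow> nat" where h: "inj_on h (carrier X)"
    using X finite_nat_injection unfolding finite_sf_def by blast
  let ?Y = "image_magma h X"
  have C: "carrier ?Y = h ` carrier X" by (simp add: image_magma_def)
  have Y: "finite_sf ?Y" using finite_sf_surj_hom[OF surj_hom_image_magma[OF h] X] .
  have "ret_total ?Y k \<longleftrightarrow> ret_total X k" for k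
    by (simp add: C ret_eq_image_magma[OF X h])
  then have "multiperm_level ?Y m"
    using lev by (simp add: multiperm_level_def card_iterated_retract[OF X, unfolded One_nat_def]
      card_iterated_retract[OF Y, unfolded One_nat_def])
  moreover have "card (carrier ?Y) = card (carrier X)" using card_image[OF h] C by simp
  ultimately show ?thesis
    unfolding N_def using Y by (intro Least_le) (auto simp: finite_sf_def)
qed

section \<open>A ten-point cycle set of level five\<close>

text \<open>The table is assembled from small pieces. The points \<open>0, 1 | 2, 3\<close> are two trivial pairs glued along
their transpositions, of level two. The points \<open>4, ..., 9\<close> form a cycle set of level three: the pairs
\<open>4, 5\<close> and \<open>8, 9\<close> swap each other's members, and \<open>5\<close> and \<open>9\<close> moreover swap \<open>6\<close> and \<open>7\<close>. The large
block acts trivially on the small one, while on the large block \<open>0\<close> and \<open>2\<close> act by the automorphism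
$(4\,8)(5\,9)(6\,7)$ and \<open>1\<close> and \<open>3\<close> act by $(6\,7)$.

The delay comes from the last clause: \<open>0\<close> and \<open>1\<close> differ only by $(4\,8)(5\,9)$, and so they cannot
merge before the large block has collapsed at stage three. They merge at stage four, and only then can
\<open>0, 1\<close> merge with \<open>2, 3\<close>.\<close>

definition base_table :: "nat list list" where
  "base_table =
    [[0, 1, 3, 2, 8, 9, 7, 6, 4, 5],
     [0, 1, 3, 2, 4, 5, 7, 6, 8, 9],
     [1, 0, 2, 3, 8, 9, 7, 6, 4, 5],
     [1, 0, 2, 3, 4, 5, 7, 6, 8, 9],
     [0, 1, 2, 3, 4, 5, 6, 7, 9, 8],
     [0, 1, 2, 3, 4, 5, 7, 6, 9, 8],
     [0, 1, 2, 3, 4, 5, 6, 7, 8, 9],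
     [0, 1, 2, 3, 4, 5, 6, 7, 8, 9],
     [0, 1, 2, 3, 5, 4, 6, 7, 8, 9],
     [0, 1, 2, 3, 5, 4, 7, 6, 8, 9]]"

definition base :: "nat magma" where
  "base = \<lparr> carrier = {..<10}, op = (\<lambda>x y. base_table ! x ! y) \<rparr>"

text \<open>The exchange of \<open>0, 1\<close> with \<open>2, 3\<close>, the identity on the large block.\<close>

definition base_auto :: "nat \<Rightarrow> nat" where
  "base_auto x = [2, 3, 0, 1, 4, 5, 6, 7, 8, 9] ! x"

lemma base_simps [simp]: "carrier base = {..<10}" "op base x y = base_table ! x ! y"
  by (simp_all add: base_def)

lemma finite_sf_base: "finite_sf base"
proof (rule finite_sfI)
  have "\<forall>x\<in>set [0..<10]. base_table ! x ! x = x"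
    unfolding base_table_def by code_simp
  then show "op base x x = x" if "x \<in> carrier base" for x
    using that by auto
  have "\<forall>x\<in>set [0..<10]. (!) (base_table ! x) ` set [0..<10] = set [0..<10]"
    unfolding base_table_def by code_simp
  then show "op base x ` carrier base = carrier base" if "x \<in> carrier base" for x
    using that by (simp add: base_def atLeast0LessThan)
  have "\<forall>x\<in>set [0..<10]. \<forall>y\<in>set [0..<10]. \<forall>z\<in>set [0..<10].
     base_table ! (base_table ! x ! y) ! (base_table ! x ! z) =
     base_table ! (base_table ! y ! x) ! (base_table ! y ! z)"
    unfolding base_table_def by code_simp
  then show "op base (op base x y) (op base x z) = op base (op base y x) (op base y z)"
    if "x \<in> carrier base" "y \<in> carrier base" "z \<in> carrier base" for x y z
    using that by auto
qed (auto simp: lessThan_empty_iff)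

lemma magma_iso_base_auto: "magma_iso base_auto base base"
proof -
  have "base_auto ` set [0..<10] = set [0..<10]"
    unfolding base_auto_def by code_simp
  then have im: "base_auto ` {..<10} = {..<10}" by (simp add: atLeast0LessThan)
  moreover from this have "inj_on base_auto {..<10}"
    by (simp add: eq_card_imp_inj_on)
  moreover have "\<forall>x\<in>set [0..<10]. \<forall>y\<in>set [0..<10].
      base_auto (base_table ! x ! y) = base_table ! base_auto x ! base_auto y"
    unfolding base_auto_def base_table_def by code_simp
  ultimately show ?thesis by (auto simp: magma_iso_def bij_betw_def)
qed

text \<open>For computing the equivalences of a concrete cycle set: classes are given by a labelling of the
points, so that each stage is a single finite check instead of a nested recursion.\<close>

lemma ret_eq_Suc_labelling:
  assumes X: "finite_sf X"
    and c: "\<And>x y. x \<in> carrier X \<Longrightarrow> y \<in> carrier X \<Longrightarrow> ret_eq X k x y \<longleftrightarrow> c x = c y"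
    and c': "\<forall>x\<in>carrier X. \<forall>y\<in>carrier X.
      c' x = c' y \<longleftrightarrow> (\<forall>z\<in>carrier X. c (op X x z) = c (op X y z))"
    and "x \<in> carrier X" "y \<in> carrier X"
  shows "ret_eq X (Suc k) x y \<longleftrightarrow> c' x = c' y"
  using assms finite_sf_op_closed[OF X] by simp

lemma twistable_base: "twistable base base_auto 4"
proof -
  \<comment> \<open>Class labels at the stages one to four; at stage five there is one class. At stage four
    the blocks \<open>0, 1\<close> and \<open>2, 3\<close>, exchanged by the automorphism, are still distinct.\<close>
  let ?c1 = "\<lambda>x. [0, 1, 2, 3, 4, 5, 6, 6, 7, 8::nat] ! x"
  let ?c2 = "\<lambda>x. [0, 1, 2, 3, 4, 4, 5, 5, 6, 6::nat] ! x"
  let ?c3 = "\<lambda>x. [0, 1, 2, 3, 4, 4, 4, 4, 4, 4::nat] ! x"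
  let ?c4 = "\<lambda>x. [0, 0, 1, 1, 2, 2, 2, 2, 2, 2::nat] ! x"
  have C: "carrier base = set [0..<10]" by (simp add: atLeast0LessThan)
  note step = ret_eq_Suc_labelling[OF finite_sf_base]
  have 1: "ret_eq base 1 x y \<longleftrightarrow> ?c1 x = ?c1 y" if "x \<in> carrier base" "y \<in> carrier base" for x y
    unfolding One_nat_def
    by (rule step[OF _ _ that, where c = id])
      (simp, unfold C base_simps id_apply base_table_def, code_simp)
  have 2: "ret_eq base (Suc 1) x y \<longleftrightarrow> ?c2 x = ?c2 y"
    if "x \<in> carrier base" "y \<in> carrier base" for x y
    by (rule step[OF 1 _ that], assumption, assumption, unfold C base_simps base_table_def, code_simp)
  have 3: "ret_eq base (Suc (Suc 1)) x y \<longleftrightarrow> ?c3 x = ?c3 y"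
    if "x \<in> carrier base" "y \<in> carrier base" for x y
    by (rule step[OF 2 _ that], assumption, assumption, unfold C base_simps base_table_def, code_simp)
  have 4: "ret_eq base (Suc (Suc (Suc 1))) x y \<longleftrightarrow> ?c4 x = ?c4 y"
    if "x \<in> carrier base" "y \<in> carrier base" for x y
    by (rule step[OF 3 _ that], assumption, assumption, unfold C base_simps base_table_def, code_simp)
  have 5: "ret_eq base (Suc (Suc (Suc (Suc 1)))) x y \<longleftrightarrow> (0::nat) = 0"
    if "x \<in> carrier base" "y \<in> carrier base" for x y
    by (rule step[OF 4 _ that, where c' = "\<lambda>_. 0"], assumption, assumption,
      unfold C base_simps base_table_def, code_simp)
  have four: "4 = Suc (Suc (Suc 1))" by simp
  have "\<not> ret_eq base 4 0 (base_auto 0)"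
    unfolding four using 4[of 0 "base_auto 0"] by (simp add: base_auto_def del: ret_eq.simps)
  then have "\<exists>x\<in>carrier base. \<not> ret_eq base 4 x (base_auto x)"
    by (intro bexI[of _ 0]) auto
  moreover have "ret_total base (Suc 4)" unfolding four using 5 by blast
  ultimately show ?thesis
    using finite_sf_base magma_iso_base_auto by (simp add: twistable_def del: ret_eq.simps)
qed

section \<open>The bound\<close>

lemma twistable_exists:
  "\<exists>(X :: nat magma) f. twistable X f (4 + i) \<and> card (carrier X) = 10 * 2 ^ i"
proof (induction i)
  case 0
  then show ?case using twistable_base by (intro exI[of _ base] exI[of _ base_auto]) simp
next
  case (Suc i)
  then obtain X :: "nat magma" and f
    where X: "twistable X f (4 + i)" "card (carrier X) = 10 * 2 ^ i" by blast
  then have "card (carrier (glue X f X f)) = 10 * 2 ^ Suc i"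
    by (simp add: card_Plus twistable_def finite_sf_def)
  then show ?case
    using nat_copy_twistable[OF twistable_double[OF X(1)]] by (metis add_Suc_right)
qed

theorem mainTheorem2:
  fixes m :: nat
  assumes "m > 5"
  shows "int (N m) \<le> 2 ^ (m - 2) - 6 * 2 ^ (m - 6) + 1"
proof -
  define i where "i = m - 6"
  have m: "m = Suc (Suc (4 + i))" using assms by (simp add: i_def)
  obtain X :: "nat magma" and f
    where X: "twistable X f (4 + i)" "card (carrier X) = 10 * 2 ^ i"
    using twistable_exists by blast
  let ?G = "glue X f \<lparr>carrier = {()}, op = \<lambda>_ y. y\<rparr> id"
  have "N m \<le> card (carrier ?G)"
    unfolding m by (intro N_le multiperm_level_adjoin_point[OF X(1)])
  also have "\<dots> = 10 * 2 ^ i + 1"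
    using X by (simp add: card_Plus twistable_def finite_sf_def)
  finally have "int (N m) \<le> int (10 * 2 ^ i + 1)" by (simp only: of_nat_le_iff)
  also have "\<dots> = 10 * 2 ^ i + 1" by simp
  also have "\<dots> = 2 ^ (m - 2) - 6 * 2 ^ (m - 6) + 1"
    by (simp add: m power_add)
  finally show ?thesis .
qed

end
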